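(* Let $(W,S)$ be an irreducible Coxeter system with $S$ finite. If the Coxeter group $W$ is infinite, then the center of $W$ is trivial.
   Context: A Coxeter group is a group $W$ having a presentation $\langle S \mid (st)^{m(s,t)}=1 \text{ for } s,t\in S\rangle$, where $S$ is a finite set and $m:S\times S\to \mathbb{N}\cup\{\infty\}$ satisfies: (1) $m(s,t)=m(t,s)$ for all $s,t\in S$; (2) $m(s,s)=1$ for all $s\in S$; (3) $m(s,t)\ge 2$ for all $s\ne t$ in $S$ (no relation is imposed when $m(s,t)=\infty$). The pair $(W,S)$ is called a Coxeter system. For $T\subset S$, $W_T$ denotes the subgroup of $W$ generated by $T$. A Coxeter system $(W,S)$ is irreducible if for every nonempty proper subset $T$ of $S$, $W$ is not the direct product of its subgroups $W_T$ and $W_{S\setminus T}$. *)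

theory Defs
  imports "HOL-Algebra.Algebra" "HOL-Library.Extended_Nat"
begin

section \<open>Free groups\<close>

text \<open>A letter \<open>(s, True)\<close> stands for the generator \<open>s\<close> and \<open>(s, False)\<close> for its formal inverse.\<close>

type_synonym 'a letter = "'a \<times> bool"

abbreviation group_words :: "'a set \<Rightarrow> 'a letter list set" where
  "group_words S \<equiv> lists (S \<times> UNIV)"

definition cancellations :: "'a set \<Rightarrow> ('a letter list \<times> 'a letter list) set" where
  "cancellations S =
     {(u @ [(s, b), (s, \<not> b)] @ v, u @ v) | u v s b.
        u \<in> group_words S \<and> v \<in> group_words S \<and> s \<in> S}"

definition free_equiv :: "'a set \<Rightarrow> ('a letter list \<times> 'a letter list) set" where
  "free_equiv S =
     (cancellations S \<union> (cancellations S)\<inverse>)\<^sup>* \<inter> group_words S \<times> group_words S"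

definition free_group :: "'a set \<Rightarrow> 'a letter list set monoid" where
  "free_group S =
     \<lparr>carrier = group_words S // free_equiv S,
      monoid.mult = (\<lambda>A B. \<Union>u\<in>A. \<Union>v\<in>B. free_equiv S `` {u @ v}),
      one = free_equiv S `` {[]}\<rparr>"

definition free_gen :: "'a set \<Rightarrow> 'a \<Rightarrow> 'a letter list set" where
  "free_gen S s = free_equiv S `` {[(s, True)]}"

lemma equiv_free_equiv: "equiv (group_words S) (free_equiv S)"
proof -
  let ?r = "cancellations S \<union> (cancellations S)\<inverse>"
  have "sym ?r" by (auto simp: sym_def)
  then have "sym (?r\<^sup>*)" by (rule sym_rtrancl)
  then show ?thesis
    unfolding free_equiv_def
    by (intro equivI refl_onI symI transI) (auto dest: symD rtrancl_trans)
qed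

lemma free_equiv_context:
  assumes "(u, v) \<in> free_equiv S" "p \<in> group_words S" "q \<in> group_words S"
  shows "(p @ u @ q, p @ v @ q) \<in> free_equiv S"
proof -
  let ?r = "cancellations S \<union> (cancellations S)\<inverse>"
  have canc: "(p @ x @ q, p @ y @ q) \<in> cancellations S" if xy: "(x, y) \<in> cancellations S" for x y
  proof -
    obtain a c s b where
      "x = a @ [(s, b), (s, \<not> b)] @ c" "y = a @ c"
      "a \<in> group_words S" "c \<in> group_words S" "s \<in> S"
      using xy unfolding cancellations_def by blast
    then show ?thesis
      using assms(2,3) unfolding cancellations_def
      by (intro CollectI exI[of _ "p @ a"] exI[of _ "c @ q"] exI[of _ s] exI[of _ b]) auto
  qed
  have "(u, v) \<in> ?r\<^sup>*" using assms(1) by (simp add: free_equiv_def)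
  then have "(p @ u @ q, p @ v @ q) \<in> ?r\<^sup>*"
    by induction (auto intro: rtrancl_into_rtrancl dest: canc)
  then show ?thesis
    using assms by (auto simp: free_equiv_def)
qed

lemma free_equiv_append:
  assumes "(u, u') \<in> free_equiv S" "(v, v') \<in> free_equiv S"
  shows "(u @ v, u' @ v') \<in> free_equiv S"
proof -
  have "u' \<in> group_words S" "v \<in> group_words S"
    using assms by (auto simp: free_equiv_def)
  then have "(u @ v, u' @ v) \<in> free_equiv S" "(u' @ v, u' @ v') \<in> free_equiv S"
    using free_equiv_context[OF assms(1), of "[]" v] free_equiv_context[OF assms(2), of u' "[]"]
    by auto
  then show ?thesis
    using equiv_free_equiv[of S] by (meson equivE transD)
qed

lemma free_class_closed:
  assumes "u \<in> group_words S"
  shows "free_equiv S `` {u} \<in> carrier (free_group S)"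
  unfolding free_group_def partial_object.simps using assms by (rule quotientI)

lemma free_mult_class:
  assumes "u \<in> group_words S" "v \<in> group_words S"
  shows "free_equiv S `` {u} \<otimes>\<^bsub>free_group S\<^esub> free_equiv S `` {v} = free_equiv S `` {u @ v}"
proof -
  have "congruent2 (free_equiv S) (free_equiv S) (\<lambda>u v. free_equiv S `` {u @ v})"
    by (rule congruent2I')
       (metis equiv_free_equiv equiv_class_eq free_equiv_append)
  then show ?thesis
    using UN_equiv_class2[OF equiv_free_equiv equiv_free_equiv] assms
    by (simp add: free_group_def)
qed

lemma free_equiv_inverse:
  assumes "u \<in> group_words S"
  shows "(rev (map (\<lambda>(s, b). (s, \<not> b)) u) @ u, []) \<in> free_equiv S"
  using assms
proof (induction u rule: list.induct)
  case Nil
  then show ?case by (simp add: free_equiv_def)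
next
  case (Cons x u)
  let ?i = "\<lambda>u. rev (map (\<lambda>(s, b). (s, \<not> b)) u)"
  obtain s b where x: "x = (s, b)" by (cases x)
  have s: "s \<in> S" using Cons.prems x by simp
  have u: "u \<in> group_words S" using Cons.prems by simp
  then have iu: "?i u \<in> group_words S" by (auto simp: in_lists_conv_set)
  have "(?i u @ [(s, \<not> b), (s, \<not> \<not> b)] @ u, ?i u @ u) \<in> cancellations S"
    unfolding cancellations_def using iu u s by blast
  then have "(?i u @ [(s, \<not> b), (s, b)] @ u, ?i u @ u) \<in> free_equiv S"
    using iu u s by (auto simp: free_equiv_def)
  with Cons.IH[OF u] have "(?i u @ [(s, \<not> b), (s, b)] @ u, []) \<in> free_equiv S"
    using equiv_free_equiv[of S] by (meson equivE transD)
  then show ?case using x by simp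
qed

lemma group_free_group: "group (free_group S)"
proof (rule groupI)
  fix A B C
  assume "A \<in> carrier (free_group S)" "B \<in> carrier (free_group S)"
    "C \<in> carrier (free_group S)"
  then obtain u v w where "A = free_equiv S `` {u}" "B = free_equiv S `` {v}"
    "C = free_equiv S `` {w}" "u \<in> group_words S" "v \<in> group_words S" "w \<in> group_words S"
    by (auto simp: free_group_def elim!: quotientE)
  then show "A \<otimes>\<^bsub>free_group S\<^esub> B \<otimes>\<^bsub>free_group S\<^esub> C =
      A \<otimes>\<^bsub>free_group S\<^esub> (B \<otimes>\<^bsub>free_group S\<^esub> C)"
    by (simp add: free_mult_class)
next
  fix A B
  assume "A \<in> carrier (free_group S)" "B \<in> carrier (free_group S)"
  then obtain u v where *: "A = free_equiv S `` {u}" "B = free_equiv S `` {v}"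
    "u \<in> group_words S" "v \<in> group_words S"
    by (auto simp: free_group_def elim!: quotientE)
  then have "A \<otimes>\<^bsub>free_group S\<^esub> B = free_equiv S `` {u @ v}"
    by (simp add: free_mult_class)
  then show "A \<otimes>\<^bsub>free_group S\<^esub> B \<in> carrier (free_group S)"
    using free_class_closed[of "u @ v" S] * by simp
next
  show "\<one>\<^bsub>free_group S\<^esub> \<in> carrier (free_group S)"
    using free_class_closed[of "[]" S] by (simp add: free_group_def)
next
  fix A
  assume "A \<in> carrier (free_group S)"
  then obtain u where A: "A = free_equiv S `` {u}" "u \<in> group_words S"
    by (auto simp: free_group_def elim!: quotientE)
  have one: "\<one>\<^bsub>free_group S\<^esub> = free_equiv S `` {[]}"
    by (simp add: free_group_def)
  show "\<one>\<^bsub>free_group S\<^esub> \<otimes>\<^bsub>free_group S\<^esub> A = A"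
    using A free_mult_class[of "[]" S u] by (simp add: one)
  let ?i = "rev (map (\<lambda>(s, b). (s, \<not> b)) u)"
  have i: "?i \<in> group_words S" using A by (auto simp: in_lists_conv_set)
  have "free_equiv S `` {?i} \<otimes>\<^bsub>free_group S\<^esub> A = \<one>\<^bsub>free_group S\<^esub>"
    using A i free_equiv_inverse[OF A(2)] equiv_class_eq[OF equiv_free_equiv]
    by (simp add: free_mult_class one)
  moreover have "free_equiv S `` {?i} \<in> carrier (free_group S)"
    using i by (rule free_class_closed)
  ultimately show "\<exists>B\<in>carrier (free_group S).
      B \<otimes>\<^bsub>free_group S\<^esub> A = \<one>\<^bsub>free_group S\<^esub>"
    by blast
qed

section \<open>Presentations\<close>

definition normal_closure :: "('a, 'b) monoid_scheme \<Rightarrow> 'a set \<Rightarrow> 'a set" where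
  "normal_closure G R = \<Inter>{N. N \<lhd> G \<and> R \<subseteq> N}"

text \<open>\<open>G = \<langle>S | R\<rangle>\<close>, where the generators are elements of \<open>G\<close> and the relators \<open>R\<close> are
  elements of the free group on \<open>S\<close>: the inclusion of \<open>S\<close> into \<open>G\<close> induces an isomorphism.\<close>

definition has_presentation ::
  "('a, 'b) monoid_scheme \<Rightarrow> 'a set \<Rightarrow> 'a letter list set set \<Rightarrow> bool" where
  "has_presentation G S R \<longleftrightarrow>
     (\<exists>\<phi> \<in> iso (free_group S Mod normal_closure (free_group S) R) G.
        \<forall>s\<in>S. \<phi> (normal_closure (free_group S) R #>\<^bsub>free_group S\<^esub> free_gen S s) = s)"

section \<open>Coxeter systems\<close>

definition coxeter_matrix :: "'a set \<Rightarrow> ('a \<Rightarrow> 'a \<Rightarrow> enat) \<Rightarrow> bool" where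
  "coxeter_matrix S m \<longleftrightarrow>
     (\<forall>s\<in>S. \<forall>t\<in>S. m s t = m t s) \<and>
     (\<forall>s\<in>S. m s s = 1) \<and>
     (\<forall>s\<in>S. \<forall>t\<in>S. s \<noteq> t \<longrightarrow> 2 \<le> m s t)"

definition coxeter_relators :: "'a set \<Rightarrow> ('a \<Rightarrow> 'a \<Rightarrow> enat) \<Rightarrow> 'a letter list set set" where
  "coxeter_relators S m =
     {(free_gen S s \<otimes>\<^bsub>free_group S\<^esub> free_gen S t) [^]\<^bsub>free_group S\<^esub> k | s t (k :: nat).
        s \<in> S \<and> t \<in> S \<and> m s t = enat k}"

definition coxeter_system :: "('a, 'b) monoid_scheme \<Rightarrow> 'a set \<Rightarrow> bool" where
  "coxeter_system W S \<longleftrightarrow>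
     group W \<and> finite S \<and> S \<subseteq> carrier W \<and>
     (\<exists>m. coxeter_matrix S m \<and> has_presentation W S (coxeter_relators S m))"

text \<open>\<open>G\<close> is the (internal) direct product of its subgroups \<open>\<langle>A\<rangle>\<close> and \<open>\<langle>B\<rangle>\<close>.\<close>

definition direct_product_of_generated ::
  "('a, 'b) monoid_scheme \<Rightarrow> 'a set \<Rightarrow> 'a set \<Rightarrow> bool" where
  "direct_product_of_generated G A B \<longleftrightarrow>
     (\<lambda>(x, y). x \<otimes>\<^bsub>G\<^esub> y) \<in> iso (subgroup_generated G A \<times>\<times> subgroup_generated G B) G"

definition irreducible_coxeter_system :: "('a, 'b) monoid_scheme \<Rightarrow> 'a set \<Rightarrow> bool" where
  "irreducible_coxeter_system W S \<longleftrightarrow>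
     coxeter_system W S \<and>
     (\<forall>T. T \<noteq> {} \<and> T \<subset> S \<longrightarrow> \<not> direct_product_of_generated W T (S - T))"

definition group_center :: "('a, 'b) monoid_scheme \<Rightarrow> 'a set" where
  "group_center G = {z \<in> carrier G. \<forall>g\<in>carrier G. z \<otimes>\<^bsub>G\<^esub> g = g \<otimes>\<^bsub>G\<^esub> z}"

end

theory Submission
  imports Defs
begin

text \<open>Let \<open>W\<close> act on \<open>W \<times> {\<plusminus>1}\<close> by letting a generator \<open>s\<close> conjugate the first component and flip the sign
  exactly at \<open>s\<close>. The signs form a cocycle that records, for each \<open>w\<close>, its finite set of inversions,
  and yields the exchange property. For a central \<open>z\<close> this set is a union of conjugacy classes of
  reflections. Let \<open>D\<close> be the set of generators that are inversions of \<open>z\<close>. A computation in the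
  dihedral group \<open>\<langle>s, t\<rangle>\<close> shows that every \<open>s \<in> D\<close> commutes with every \<open>t \<in> S - D\<close>, so
  irreducibility leaves only \<open>D = {}\<close> and \<open>D = S\<close>. In the first case \<open>z\<close> has no descent and is trivial.
  In the second case every reflection is an inversion of \<open>z\<close>; so there are finitely many reflections,
  and \<open>W\<close> is finite because an element is determined by its inversions.\<close>

section \<open>Preliminaries on groups\<close>

lemma (in group) pow_eq_one_odd:
  assumes "x \<in> carrier G" "x \<otimes> x = \<one>" "x [^] k = \<one>" "odd (k::nat)"
  shows "x = \<one>"
proof -
  from \<open>odd k\<close> obtain j where "k = Suc (2 * j)" using oddE by fastforce
  then have "x [^] k = (x [^] (2::nat)) [^] j \<otimes> x"
    using assms(1) by (simp add: nat_pow_pow)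
  then show ?thesis using assms by (simp add: numeral_2_eq_2)
qed

lemma (in group) pow_eq_one_even:
  assumes "x \<in> carrier G" "x \<otimes> x = \<one>" "even (k::nat)"
  shows "x [^] k = \<one>"
proof -
  from \<open>even k\<close> obtain j where "k = 2 * j" by blast
  then have "x [^] k = (x [^] (2::nat)) [^] j"
    using assms(1) by (simp add: nat_pow_pow)
  then show ?thesis using assms by (simp add: numeral_2_eq_2)
qed

lemma (in group) hom_eq_on_generate:
  assumes "h \<in> hom G H" "k \<in> hom G H" "group H" "A \<subseteq> carrier G"
    and "\<And>a. a \<in> A \<Longrightarrow> h a = k a" "x \<in> generate G A"
  shows "h x = k x"
proof -
  interpret h: group_hom G H h using assms by (simp add: group_hom_def group_hom_axioms_def is_group)
  interpret k: group_hom G H k using assms by (simp add: group_hom_def group_hom_axioms_def is_group)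
  have "x \<in> carrier G \<and> h x = k x"
    using \<open>x \<in> generate G A\<close> assms(4,5) by induction (auto simp: subset_iff)
  then show ?thesis ..
qed

text \<open>Centralizers are subgroups. Hence \<open>generate G A\<close> lies in the centralizer of
  \<open>B\<close>, so \<open>B\<close> lies in the centralizer of \<open>generate G A\<close>, and
  \<open>generate G B\<close> follows it there.\<close>

lemma (in group) commute_generate:
  assumes "A \<subseteq> carrier G" "B \<subseteq> carrier G"
    and comm: "\<And>a b. a \<in> A \<Longrightarrow> b \<in> B \<Longrightarrow> a \<otimes> b = b \<otimes> a"
    and "x \<in> generate G A" "y \<in> generate G B"
  shows "x \<otimes> y = y \<otimes> x"
proof -
  let ?C = "\<lambda>Y. {x \<in> carrier G. \<forall>y\<in>Y. x \<otimes> y = y \<otimes> x}"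
  have sub: "subgroup (?C Y) G" if "Y \<subseteq> carrier G" for Y
  proof (rule subgroupI)
    fix a assume a: "a \<in> ?C Y"
    have "inv a \<otimes> y = y \<otimes> inv a" if "y \<in> Y" for y
    proof -
      have y: "y \<in> carrier G" using that \<open>Y \<subseteq> carrier G\<close> by auto
      have "inv a \<otimes> y = inv a \<otimes> (y \<otimes> a) \<otimes> inv a" using a y by (simp add: m_assoc)
      also have "y \<otimes> a = a \<otimes> y" using a that by auto
      also have "inv a \<otimes> (a \<otimes> y) \<otimes> inv a = y \<otimes> inv a" using a y by (simp flip: m_assoc)
      finally show ?thesis .
    qed
    then show "inv a \<in> ?C Y" using a by auto
  next
    fix a b assume a: "a \<in> ?C Y" and b: "b \<in> ?C Y"
    have "a \<otimes> b \<otimes> y = y \<otimes> (a \<otimes> b)" if "y \<in> Y" for y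
    proof -
      have y: "y \<in> carrier G" using that \<open>Y \<subseteq> carrier G\<close> by auto
      have ay: "a \<otimes> y = y \<otimes> a" and yb: "b \<otimes> y = y \<otimes> b" using a b that by auto
      have "a \<otimes> b \<otimes> y = a \<otimes> (b \<otimes> y)" using a b y by (simp add: m_assoc)
      also note yb
      also have "a \<otimes> (y \<otimes> b) = a \<otimes> y \<otimes> b" using a b y by (simp add: m_assoc)
      also have "\<dots> = y \<otimes> a \<otimes> b" by (rule arg_cong[OF ay, of "\<lambda>z. z \<otimes> b"])
      also have "\<dots> = y \<otimes> (a \<otimes> b)" using a b y by (simp add: m_assoc)
      finally show ?thesis .
    qed
    then show "a \<otimes> b \<in> ?C Y" using a b by auto
  qed (use that in \<open>auto intro!: exI[of _ \<one>]\<close>)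
  have "generate G A \<subseteq> ?C B"
    using assms(1,2) comm by (intro generate_subgroup_incl sub) auto
  then have "B \<subseteq> ?C (generate G A)"
    using assms(2) by auto
  then have "generate G B \<subseteq> ?C (generate G A)"
    using sub[OF generate_incl[OF assms(1)]] by (rule generate_subgroup_incl)
  then show ?thesis using assms(4,5) by auto
qed

section \<open>Universal property of presentations\<close>

definition word_eval :: "('b, 'c) monoid_scheme \<Rightarrow> ('a \<Rightarrow> 'b) \<Rightarrow> 'a letter list \<Rightarrow> 'b" where
  "word_eval H f u = foldr (\<lambda>(s, b) y. (if b then f s else inv\<^bsub>H\<^esub> f s) \<otimes>\<^bsub>H\<^esub> y) u \<one>\<^bsub>H\<^esub>"

lemma word_eval_Nil [simp]: "word_eval H f [] = \<one>\<^bsub>H\<^esub>"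
  by (simp add: word_eval_def)

lemma word_eval_Cons [simp]:
  "word_eval H f ((s, b) # u) = (if b then f s else inv\<^bsub>H\<^esub> f s) \<otimes>\<^bsub>H\<^esub> word_eval H f u"
  by (simp add: word_eval_def)

context group
begin

lemma word_eval_closed:
  assumes "f \<in> S \<rightarrow> carrier G" "u \<in> group_words S"
  shows "word_eval G f u \<in> carrier G"
  using assms(2)
proof induction
  case (Cons a l)
  then show ?case using assms(1) by (cases a) auto
qed simp

lemma word_eval_append:
  assumes "f \<in> S \<rightarrow> carrier G" "u \<in> group_words S" "v \<in> group_words S"
  shows "word_eval G f (u @ v) = word_eval G f u \<otimes> word_eval G f v"
  using assms(2)
proof induction
  case (Cons a l)
  moreover obtain s b where "a = (s, b)" by (cases a)
  ultimately show ?case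
    using assms(1,3) word_eval_closed[OF assms(1)] by (auto simp: m_assoc Pi_iff)
qed (use assms(3) word_eval_closed[OF assms(1)] in simp)

lemma word_eval_cancellation:
  assumes f: "f \<in> S \<rightarrow> carrier G" and "(u, v) \<in> cancellations S"
  shows "word_eval G f u = word_eval G f v"
proof -
  obtain p q s b where *: "u = p @ [(s, b), (s, \<not> b)] @ q" "v = p @ q"
    "p \<in> group_words S" "q \<in> group_words S" "s \<in> S"
    using assms(2) unfolding cancellations_def by blast
  have "f s \<in> carrier G" using f \<open>s \<in> S\<close> by auto
  then have "word_eval G f ([(s, b), (s, \<not> b)] @ q) = word_eval G f q"
    using word_eval_closed[OF f \<open>q \<in> _\<close>] by (simp flip: m_assoc)
  moreover have "[(s, b), (s, \<not> b)] @ q \<in> group_words S" using * by simp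
  ultimately show ?thesis
    using * word_eval_append[OF f] by metis
qed

lemma word_eval_free_equiv:
  assumes f: "f \<in> S \<rightarrow> carrier G" and "(u, v) \<in> free_equiv S"
  shows "word_eval G f u = word_eval G f v"
proof -
  have "(u, v) \<in> (cancellations S \<union> (cancellations S)\<inverse>)\<^sup>*"
    using assms(2) by (simp add: free_equiv_def)
  then show ?thesis
    by induction (use word_eval_cancellation[OF f] in auto)
qed

lemma free_group_universal:
  assumes f: "f \<in> S \<rightarrow> carrier G"
  obtains h where "h \<in> hom (free_group S) G" "\<And>s. s \<in> S \<Longrightarrow> h (free_gen S s) = f s"
proof -
  \<comment> \<open>\<open>word_eval\<close> is constant on each class, so the image of a class is a
    singleton and \<open>the_elem\<close> reads off its value.\<close>
  define h where "h A = the_elem (word_eval G f ` A)" for A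
  have h: "h (free_equiv S `` {u}) = word_eval G f u" if "u \<in> group_words S" for u
  proof -
    have "u \<in> free_equiv S `` {u}" using that equiv_class_self[OF equiv_free_equiv] by metis
    moreover have "word_eval G f ` (free_equiv S `` {u}) = (\<lambda>_. word_eval G f u) ` (free_equiv S `` {u})"
      using word_eval_free_equiv[OF f, of u] by (intro image_cong) (simp_all add: Image_singleton_iff)
    ultimately have "word_eval G f ` (free_equiv S `` {u}) = {word_eval G f u}"
      by (metis image_constant)
    then show ?thesis by (simp add: h_def)
  qed
  show thesis
  proof
    show "h \<in> hom (free_group S) G"
    proof (rule homI)
      fix A assume "A \<in> carrier (free_group S)"
      then obtain u where "A = free_equiv S `` {u}" "u \<in> group_words S"
        by (auto simp: free_group_def elim!: quotientE)
      then show "h A \<in> carrier G"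
        using word_eval_closed[OF f] h by metis
    next
      fix A B assume "A \<in> carrier (free_group S)" "B \<in> carrier (free_group S)"
      then obtain u v where uv: "A = free_equiv S `` {u}" "B = free_equiv S `` {v}"
        "u \<in> group_words S" "v \<in> group_words S"
        by (auto simp: free_group_def elim!: quotientE)
      then have "u @ v \<in> group_words S" by simp
      then show "h (A \<otimes>\<^bsub>free_group S\<^esub> B) = h A \<otimes> h B"
        using uv by (simp add: free_mult_class h word_eval_append[OF f])
    qed
    show "h (free_gen S s) = f s" if "s \<in> S" for s
      using that f by (auto simp: free_gen_def h Pi_iff)
  qed
qed

end

lemma free_gen_closed: "s \<in> S \<Longrightarrow> free_gen S s \<in> carrier (free_group S)"
  unfolding free_gen_def by (rule free_class_closed) simp

lemma free_group_generated:
  "generate (free_group S) (free_gen S ` S) = carrier (free_group S)"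
proof -
  interpret F: group "free_group S" by (rule group_free_group)
  have one: "\<one>\<^bsub>free_group S\<^esub> = free_equiv S `` {[]}"
    by (simp add: free_group_def)
  have letter: "free_equiv S `` {[(s, b)]} \<in> generate (free_group S) (free_gen S ` S)"
    if "s \<in> S" for s b
  proof (cases b)
    case True
    then have "free_equiv S `` {[(s, b)]} = free_gen S s" by (simp add: free_gen_def)
    then show ?thesis using that by (simp add: generate.incl)
  next
    case False
    have "([(s, False), (s, True)], []) \<in> free_equiv S"
      using free_equiv_inverse[of "[(s, True)]" S] that by simp
    then have "free_equiv S `` {[(s, False), (s, True)]} = free_equiv S `` {[]}"
      using equiv_class_eq[OF equiv_free_equiv] by metis
    then have "free_equiv S `` {[(s, False)]} \<otimes>\<^bsub>free_group S\<^esub> free_gen S s = \<one>\<^bsub>free_group S\<^esub>"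
      using that by (simp add: free_gen_def free_mult_class one)
    then have "free_equiv S `` {[(s, False)]} = inv\<^bsub>free_group S\<^esub> free_gen S s"
      using that F.inv_equality[OF _ free_gen_closed[OF that]] free_class_closed[of "[(s, False)]" S]
      by simp
    then show ?thesis using that False by (simp add: generate.inv)
  qed
  have "free_equiv S `` {u} \<in> generate (free_group S) (free_gen S ` S)"
    if "u \<in> group_words S" for u
    using that
  proof induction
    case Nil
    then show ?case using generate.one one by metis
  next
    case (Cons a u)
    then have "free_equiv S `` {a # u} = free_equiv S `` {[a]} \<otimes>\<^bsub>free_group S\<^esub> free_equiv S `` {u}"
      by (subst free_mult_class) auto
    moreover have "free_equiv S `` {[a]} \<in> generate (free_group S) (free_gen S ` S)"
      using Cons letter by (cases a) auto
    ultimately show ?case using Cons generate.eng by metis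
  qed
  then have "carrier (free_group S) \<subseteq> generate (free_group S) (free_gen S ` S)"
    by (auto simp: free_group_def elim!: quotientE)
  moreover have "free_gen S ` S \<subseteq> carrier (free_group S)" by (auto intro: free_gen_closed)
  ultimately show ?thesis using F.generate_incl by (intro equalityI)
qed

section \<open>Normal closures and quotients by relators\<close>

lemma (in group) normal_closure_normal:
  assumes "R \<subseteq> carrier G"
  shows "normal_closure G R \<lhd> G"
proof -
  \<comment> \<open>The whole group belongs to the family, so the intersection is not the empty one,
    which would be \<open>UNIV\<close>.\<close>
  have "carrier G \<lhd> G" by (simp add: normal_inv_iff subgroup_self)
  then have ne: "{N. N \<lhd> G \<and> R \<subseteq> N} \<noteq> {}" using assms by blast
  have "subgroup (\<Inter>{N. N \<lhd> G \<and> R \<subseteq> N}) G"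
    using ne by (intro subgroups_Inter) (auto simp: normal_inv_iff)
  then show ?thesis
    unfolding normal_closure_def by (auto simp: normal_inv_iff)
qed

lemma normal_closure_incl: "R \<subseteq> normal_closure G R"
  by (auto simp: normal_closure_def)

lemma normal_closure_least: "N \<lhd> G \<Longrightarrow> R \<subseteq> N \<Longrightarrow> normal_closure G R \<subseteq> N"
  by (auto simp: normal_closure_def)

text \<open>\<open>p\<close> is the quotient map followed by the isomorphism of the presentation;
  since the latter is injective, the kernel is exactly the normal closure.\<close>

lemma presentation_projection:
  assumes "has_presentation W S R" "group W" "R \<subseteq> carrier (free_group S)"
  obtains p where "p \<in> hom (free_group S) W" "p ` carrier (free_group S) = carrier W"
    "kernel (free_group S) W p = normal_closure (free_group S) R"
    "\<And>s. s \<in> S \<Longrightarrow> p (free_gen S s) = s"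
proof -
  let ?F = "free_group S"
  let ?N = "normal_closure ?F R"
  interpret W: group W by fact
  interpret F: group ?F by (rule group_free_group)
  interpret N: normal ?N ?F by (rule F.normal_closure_normal) fact
  obtain \<phi> where \<phi>: "\<phi> \<in> iso (?F Mod ?N) W"
    and gen: "\<forall>s\<in>S. \<phi> (?N #>\<^bsub>?F\<^esub> free_gen S s) = s"
    using assms(1) unfolding has_presentation_def by blast
  have M: "group (?F Mod ?N)" by (rule N.factorgroup_is_group)
  have \<phi>hom: "\<phi> \<in> hom (?F Mod ?N) W" and bij: "bij_betw \<phi> (carrier (?F Mod ?N)) (carrier W)"
    using \<phi> by (auto simp: iso_def)
  define p where "p = (\<lambda>x. \<phi> (?N #>\<^bsub>?F\<^esub> x))"
  have p: "p \<in> hom ?F W"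
    using hom_compose[OF N.r_coset_hom_Mod \<phi>hom] by (simp add: p_def comp_def)
  have carr: "carrier (?F Mod ?N) = (\<lambda>x. ?N #>\<^bsub>?F\<^esub> x) ` carrier ?F"
    by (auto simp: FactGroup_def RCOSETS_def)
  show thesis
  proof
    show "p \<in> hom ?F W" by fact
    show "p ` carrier ?F = carrier W"
      using bij unfolding carr p_def bij_betw_def by (auto simp: image_image)
    show "kernel ?F W p = ?N"
    proof -
      have one: "\<phi> ?N = \<one>\<^bsub>W\<^esub>"
        using hom_one[OF \<phi>hom M W.is_group] by simp
      have "p x = \<one>\<^bsub>W\<^esub> \<longleftrightarrow> x \<in> ?N" if "x \<in> carrier ?F" for x
      proof -
        have "?N \<in> carrier (?F Mod ?N)"
          using monoid.one_closed[OF group.is_monoid[OF M]] by simp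
        moreover have "?N #>\<^bsub>?F\<^esub> x \<in> carrier (?F Mod ?N)" using that carr by blast
        ultimately have "p x = \<one>\<^bsub>W\<^esub> \<longleftrightarrow> ?N #>\<^bsub>?F\<^esub> x = ?N"
          using bij one unfolding bij_betw_def p_def by (metis inj_onD)
        also have "\<dots> \<longleftrightarrow> x \<in> ?N"
          using that F.coset_join1 F.coset_join2 N.subgroup_axioms N.subset by metis
        finally show ?thesis .
      qed
      then show ?thesis using N.subset by (auto simp: kernel_def)
    qed
    show "p (free_gen S s) = s" if "s \<in> S" for s
      using gen that by (simp add: p_def)
  qed
qed

lemma presentation_generated:
  assumes "has_presentation W S R" "group W" "R \<subseteq> carrier (free_group S)"
  shows "generate W S = carrier W"
proof -
  interpret W: group W by fact
  interpret F: group "free_group S" by (rule group_free_group)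
  obtain p where p: "p \<in> hom (free_group S) W" "p ` carrier (free_group S) = carrier W"
    "\<And>s. s \<in> S \<Longrightarrow> p (free_gen S s) = s"
    using presentation_projection[OF assms] by metis
  interpret group_hom "free_group S" W p
    using p(1) by unfold_locales
  have "p ` free_gen S ` S = S" using p(3) by force
  then show ?thesis
    using generate_img[of "free_gen S ` S"] free_group_generated[of S] free_gen_closed[of _ S] p(2)
    by (metis image_subsetI)
qed

text \<open>The kernel of \<open>k\<close> is normal and contains \<open>R\<close>, hence the normal
  closure, so \<open>k\<close> factors through the quotient. The inverse of the isomorphism of the
  presentation carries the factored map over to \<open>W\<close>.\<close>

lemma presentation_universal:
  assumes "has_presentation W S R" "group W" "R \<subseteq> carrier (free_group S)"
    and "group H" "k \<in> hom (free_group S) H" "\<And>r. r \<in> R \<Longrightarrow> k r = \<one>\<^bsub>H\<^esub>"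
  obtains h where "h \<in> hom W H" "\<And>s. s \<in> S \<Longrightarrow> h s = k (free_gen S s)"
proof -
  let ?F = "free_group S"
  let ?N = "normal_closure ?F R"
  interpret W: group W by fact
  interpret F: group ?F by (rule group_free_group)
  interpret H: group H by fact
  interpret k: group_hom ?F H k using assms(5) by unfold_locales
  obtain \<phi> where \<phi>: "\<phi> \<in> iso (?F Mod ?N) W"
    and gen: "\<forall>s\<in>S. \<phi> (?N #>\<^bsub>?F\<^esub> free_gen S s) = s"
    using assms(1) unfolding has_presentation_def by blast
  interpret N: normal ?N ?F by (rule F.normal_closure_normal) fact
  have "?N \<subseteq> kernel ?F H k"
    using assms(3,6) k.normal_kernel by (intro normal_closure_least) (auto simp: kernel_def)
  then obtain g where g: "g \<in> hom (?F Mod ?N) H"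
    "\<And>x. x \<in> carrier ?F \<Longrightarrow> g (?N #>\<^bsub>?F\<^esub> x) = k x"
    using k.FactGroup_universal_kernel[OF N.normal_axioms] by blast
  let ?\<psi> = "inv_into (carrier (?F Mod ?N)) \<phi>"
  have \<psi>: "?\<psi> \<in> iso W (?F Mod ?N)"
    using group.iso_set_sym[OF N.factorgroup_is_group \<phi>] .
  show thesis
  proof
    show "g \<circ> ?\<psi> \<in> hom W H"
      using \<psi> g(1) hom_compose by (fastforce simp: iso_def)
    show "(g \<circ> ?\<psi>) s = k (free_gen S s)" if "s \<in> S" for s
    proof -
      have c: "?N #>\<^bsub>?F\<^esub> free_gen S s \<in> carrier (?F Mod ?N)"
        using free_gen_closed[OF that] by (auto simp: FactGroup_def RCOSETS_def)
      have "inj_on \<phi> (carrier (?F Mod ?N))" using \<phi> by (simp add: iso_def bij_betw_def)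
      then have "?\<psi> s = ?N #>\<^bsub>?F\<^esub> free_gen S s"
        using gen c that inv_into_f_f by fastforce
      then show ?thesis using g(2) free_gen_closed[OF that] by simp
    qed
  qed
qed

section \<open>Presentations with Coxeter relators\<close>

lemma coxeter_relators_closed: "coxeter_relators S m \<subseteq> carrier (free_group S)"
proof -
  interpret F: group "free_group S" by (rule group_free_group)
  show ?thesis by (auto simp: coxeter_relators_def free_gen_closed)
qed

lemma coxeter_relation:
  assumes "has_presentation W S (coxeter_relators S m)" "group W"
    and "s \<in> S" "t \<in> S" "m s t = enat k"
  shows "(s \<otimes>\<^bsub>W\<^esub> t) [^]\<^bsub>W\<^esub> k = \<one>\<^bsub>W\<^esub>"
proof -
  interpret W: group W by fact
  interpret F: group "free_group S" by (rule group_free_group)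
  obtain p where p: "p \<in> hom (free_group S) W"
    "kernel (free_group S) W p = normal_closure (free_group S) (coxeter_relators S m)"
    "\<And>s. s \<in> S \<Longrightarrow> p (free_gen S s) = s"
    using presentation_projection[OF assms(1,2) coxeter_relators_closed] by metis
  interpret p: group_hom "free_group S" W p using p(1) by unfold_locales
  let ?r = "(free_gen S s \<otimes>\<^bsub>free_group S\<^esub> free_gen S t) [^]\<^bsub>free_group S\<^esub> k"
  have "?r \<in> coxeter_relators S m" using assms by (auto simp: coxeter_relators_def)
  then have "?r \<in> kernel (free_group S) W p" unfolding p(2) by (rule subsetD[OF normal_closure_incl])
  then have "p ?r = \<one>\<^bsub>W\<^esub>" by (simp add: kernel_def)
  then show ?thesis using assms(3,4) p(3) by (simp add: p.hom_nat_pow free_gen_closed)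
qed

text \<open>Serves twice: to build the action on signed group elements, and to build the retraction
  that splits \<open>W\<close> as a direct product.\<close>

lemma coxeter_universal:
  assumes "has_presentation W S (coxeter_relators S m)" "group W"
    and "group H" "f \<in> S \<rightarrow> carrier H"
    and "\<And>s t k. s \<in> S \<Longrightarrow> t \<in> S \<Longrightarrow> m s t = enat k \<Longrightarrow> (f s \<otimes>\<^bsub>H\<^esub> f t) [^]\<^bsub>H\<^esub> k = \<one>\<^bsub>H\<^esub>"
  obtains h where "h \<in> hom W H" "\<And>s. s \<in> S \<Longrightarrow> h s = f s"
proof -
  interpret F: group "free_group S" by (rule group_free_group)
  interpret H: group H by fact
  obtain k where k: "k \<in> hom (free_group S) H" "\<And>s. s \<in> S \<Longrightarrow> k (free_gen S s) = f s"
    using H.free_group_universal[OF assms(4)] by blast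
  interpret k: group_hom "free_group S" H k using k(1) by unfold_locales
  have "k r = \<one>\<^bsub>H\<^esub>" if "r \<in> coxeter_relators S m" for r
    using that assms(5) k(2) by (auto simp: coxeter_relators_def free_gen_closed k.hom_nat_pow)
  then show thesis
    using presentation_universal[OF assms(1,2) coxeter_relators_closed assms(3) k(1)] k(2) that
    by metis
qed

section \<open>Inversion cocycles\<close>

text \<open>\<open>\<nu> w x\<close> says that the reflection \<open>x\<close> is a left inversion of \<open>w\<close>, i.e. that left multiplication
  by \<open>x\<close> shortens \<open>w\<close>. Letting \<open>x\<close> range over the whole group is harmless.\<close>

locale reflection_cocycle = group G for G (structure) +
  fixes S :: "'a set" and \<nu> :: "'a \<Rightarrow> 'a \<Rightarrow> bool"
  assumes gens_closed: "S \<subseteq> carrier G"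
    and gens_involutive: "s \<in> S \<Longrightarrow> s \<otimes> s = \<one>"
    and gens_generate: "generate G S = carrier G"
    and cocycle_gen: "s \<in> S \<Longrightarrow> x \<in> carrier G \<Longrightarrow> \<nu> s x \<longleftrightarrow> x = s"
    and cocycle_mult: "a \<in> carrier G \<Longrightarrow> b \<in> carrier G \<Longrightarrow> x \<in> carrier G \<Longrightarrow>
      \<nu> (a \<otimes> b) x \<longleftrightarrow> \<nu> a x \<noteq> \<nu> b (inv a \<otimes> x \<otimes> a)"
begin

section \<open>Words in the generators\<close>

abbreviation word_prod :: "'a list \<Rightarrow> 'a" where
  "word_prod xs \<equiv> foldr (\<otimes>) xs \<one>"

lemma gen_closed [simp]: "s \<in> S \<Longrightarrow> s \<in> carrier G"
  using gens_closed by blast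

lemma gen_inv: "s \<in> S \<Longrightarrow> inv s = s"
  using gens_involutive by (simp add: inv_equality)

lemma gen_cancel: "s \<in> S \<Longrightarrow> x \<in> carrier G \<Longrightarrow> s \<otimes> (s \<otimes> x) = x"
  using gens_involutive by (simp flip: m_assoc)

lemma word_prod_closed: "xs \<in> lists S \<Longrightarrow> word_prod xs \<in> carrier G"
  by (induction xs rule: lists.induct) auto

lemma word_prod_append:
  "xs \<in> lists S \<Longrightarrow> ys \<in> lists S \<Longrightarrow> word_prod (xs @ ys) = word_prod xs \<otimes> word_prod ys"
proof (induction xs rule: lists.induct)
  case (Cons a l)
  then have "word_prod (l @ ys) = word_prod l \<otimes> word_prod ys" by blast
  then show ?case using Cons.hyps Cons.prems by (simp add: m_assoc word_prod_closed)
qed (simp add: word_prod_closed)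

text \<open>Generators are their own inverses, so words without inverse letters suffice. The subset
  \<open>I\<close> stays general because words must later remain inside a dihedral subgroup.\<close>

lemma generate_word:
  assumes "I \<subseteq> S" "w \<in> generate G I"
  obtains xs where "xs \<in> lists I" "w = word_prod xs"
proof -
  have "\<exists>xs\<in>lists I. w = word_prod xs"
    using assms(2)
  proof induction
    case one
    show ?case by (rule bexI[of _ "[]"]) auto
  next
    case (incl h)
    then show ?case using assms(1) by (intro bexI[of _ "[h]"]) auto
  next
    case (inv h)
    then show ?case using assms(1) by (intro bexI[of _ "[h]"]) (auto simp: gen_inv)
  next
    case (eng h1 h2)
    then obtain xs ys where *: "xs \<in> lists I" "ys \<in> lists I" "h1 = word_prod xs" "h2 = word_prod ys"
      by blast
    moreover have "lists I \<subseteq> lists S" using assms(1) by (rule lists_mono)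
    ultimately have "h1 \<otimes> h2 = word_prod (xs @ ys)"
      using word_prod_append by (metis subsetD)
    then show ?case using * by (intro bexI[of _ "xs @ ys"]) auto
  qed
  then show thesis using that by blast
qed

lemma word:
  assumes "w \<in> carrier G"
  obtains xs where "xs \<in> lists S" "w = word_prod xs"
  using generate_word[of S w] assms gens_generate by auto

section \<open>Exchange, descents and inversion sets\<close>

text \<open>For \<open>a = b = \<one>\<close> the cocycle identity equates
  \<open>\<nu> \<one> x\<close> with its exclusive or with itself.\<close>

lemma cocycle_one: "x \<in> carrier G \<Longrightarrow> \<not> \<nu> \<one> x"
  using cocycle_mult[of \<one> \<one> x] by simp

lemma cocycle_gen_mult:
  assumes "s \<in> S" "a \<in> carrier G" "x \<in> carrier G"
  shows "\<nu> (s \<otimes> a) x \<longleftrightarrow> (x = s) \<noteq> \<nu> a (s \<otimes> x \<otimes> s)"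
  using assms by (simp add: cocycle_mult cocycle_gen gen_inv)

text \<open>One letter gets deleted. If \<open>x\<close> is the first letter \<open>s\<close>, that
  letter cancels; otherwise \<open>s \<otimes> x \<otimes> s\<close> is an inversion of the tail,
  and \<open>x \<otimes> s = s \<otimes> (s \<otimes> x \<otimes> s)\<close> moves the deletion into
  the tail.\<close>

lemma exchange:
  assumes "I \<subseteq> S" "xs \<in> lists I" "x \<in> carrier G" "\<nu> (word_prod xs) x"
  obtains ys where "ys \<in> lists I" "length ys < length xs" "x \<otimes> word_prod xs = word_prod ys"
proof -
  have "\<exists>ys\<in>lists I. length ys < length xs \<and> x \<otimes> word_prod xs = word_prod ys"
    using assms(2-)
  proof (induction xs arbitrary: x rule: lists.induct)
    case Nil
    then show ?case using cocycle_one by simp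
  next
    case (Cons s xs)
    have s: "s \<in> S" and xs: "xs \<in> lists S" using Cons assms(1) lists_mono by auto
    note p = word_prod_closed[OF xs]
    show ?case
    proof (cases "x = s")
      case True
      then show ?thesis using Cons s p by (intro bexI[of _ xs]) (auto simp: gen_cancel)
    next
      case False
      then have "\<nu> (word_prod xs) (s \<otimes> x \<otimes> s)"
        using Cons.prems s p by (simp add: cocycle_gen_mult)
      then obtain ys where ys: "ys \<in> lists I" "length ys < length xs"
        "s \<otimes> x \<otimes> s \<otimes> word_prod xs = word_prod ys"
        using Cons.IH[of "s \<otimes> x \<otimes> s"] Cons.prems s by auto
      have "s \<otimes> word_prod ys = x \<otimes> word_prod (s # xs)"
        using s p Cons.prems by (simp add: ys(3)[symmetric] m_assoc gen_cancel)
      then show ?thesis using ys Cons.hyps by (intro bexI[of _ "s # ys"]) auto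
    qed
  qed
  then show thesis using that by blast
qed

text \<open>The first letter of a shortest word over \<open>I\<close> works: were it an inversion of
  the tail, exchange would give a shorter word for \<open>w\<close>.\<close>

lemma descent_exists:
  assumes I: "I \<subseteq> S" and w: "w \<in> generate G I" "w \<noteq> \<one>"
  obtains s where "s \<in> I" "\<nu> w s"
proof -
  let ?P = "\<lambda>xs. xs \<in> lists I \<and> word_prod xs = w"
  obtain xs where "?P xs" using generate_word[OF I w(1)] by metis
  then obtain xs where xs: "xs \<in> lists I" "word_prod xs = w"
    and min: "\<And>ys. ?P ys \<Longrightarrow> length xs \<le> length ys"
    using ex_has_least_nat[of ?P xs length] by blast
  obtain s ys where sys: "xs = s # ys" using xs w(2) by (cases xs) auto
  have s: "s \<in> I" "s \<in> S" and ys: "ys \<in> lists I" "ys \<in> lists S"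
    using xs sys I lists_mono by auto
  note p = word_prod_closed[OF ys(2)]
  have w_eq: "w = s \<otimes> word_prod ys" using xs sys by simp
  have "\<not> \<nu> (word_prod ys) s"
  proof
    assume "\<nu> (word_prod ys) s"
    then obtain zs where "zs \<in> lists I" "length zs < length ys" "s \<otimes> word_prod ys = word_prod zs"
      using exchange[OF I ys(1) gen_closed[OF s(2)]] by blast
    then show False using min[of zs] w_eq sys by simp
  qed
  then have "\<nu> w s"
    using s p by (simp add: w_eq cocycle_gen_mult gens_involutive)
  then show thesis using that s by blast
qed

lemma cocycle_inj:
  assumes "u \<in> carrier G" "v \<in> carrier G" "\<And>x. x \<in> carrier G \<Longrightarrow> \<nu> u x \<longleftrightarrow> \<nu> v x"
  shows "u = v"
proof -
  have "\<not> \<nu> (inv v \<otimes> u) x" if "x \<in> carrier G" for x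
    \<comment> \<open>The identity for \<open>inv v \<otimes> v = \<one>\<close> expresses
      \<open>\<nu> (inv v) x\<close> through \<open>\<nu> v\<close>; since \<open>\<nu> u\<close>
      and \<open>\<nu> v\<close> agree, the two terms for \<open>inv v \<otimes> u\<close>
      cancel.\<close>
    using assms that cocycle_one[OF that] cocycle_mult[of "inv v" u x] cocycle_mult[of "inv v" v x]
    by simp
  moreover have "inv v \<otimes> u \<in> generate G S" using assms gens_generate by simp
  ultimately have "inv v \<otimes> u = \<one>"
    using descent_exists[of S "inv v \<otimes> u"] gen_closed by blast
  then show ?thesis using assms by (metis inv_equality inv_inv inv_closed)
qed

text \<open>Prepending a letter \<open>s\<close> conjugates the inversions by \<open>s\<close> and
  can add at most \<open>s\<close> itself.\<close>

lemma finite_inversions: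
  assumes "w \<in> carrier G"
  shows "finite {x \<in> carrier G. \<nu> w x}"
proof -
  obtain xs where xs: "xs \<in> lists S" "w = word_prod xs" using word[OF assms] .
  have "finite {x \<in> carrier G. \<nu> (word_prod xs) x}"
    using xs(1)
  proof induction
    case Nil
    have "{x \<in> carrier G. \<nu> (word_prod []) x} = {}" using cocycle_one by auto
    then show ?case by (simp only: finite.emptyI)
  next
    case (Cons s xs)
    note p = word_prod_closed[OF Cons(2)]
    have "{x \<in> carrier G. \<nu> (word_prod (s # xs)) x} \<subseteq>
      insert s ((\<lambda>y. s \<otimes> y \<otimes> s) ` {x \<in> carrier G. \<nu> (word_prod xs) x})"
    proof
      fix x assume "x \<in> {x \<in> carrier G. \<nu> (word_prod (s # xs)) x}"
      then have x: "x \<in> carrier G" "\<nu> (s \<otimes> word_prod xs) x" by auto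
      show "x \<in> insert s ((\<lambda>y. s \<otimes> y \<otimes> s) ` {x \<in> carrier G. \<nu> (word_prod xs) x})"
      proof (cases "x = s")
        case False
        then have "\<nu> (word_prod xs) (s \<otimes> x \<otimes> s)"
          using x Cons(1) p by (simp add: cocycle_gen_mult)
        moreover have "x = s \<otimes> (s \<otimes> x \<otimes> s) \<otimes> s"
          using x Cons(1) by (simp add: m_assoc gen_cancel gens_involutive)
        ultimately show ?thesis using x Cons(1) by (intro insertI2 image_eqI) auto
      qed simp
    qed
    then show ?case using Cons finite_subset by blast
  qed
  then show ?thesis using xs by simp
qed

text \<open>Justifies letting the second argument of \<open>\<nu>\<close> range over the whole
  group: only conjugates of generators can be inversions.\<close>

lemma inversion_is_reflection:
  assumes "w \<in> carrier G" "x \<in> carrier G" "\<nu> w x"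
  obtains g s where "g \<in> carrier G" "s \<in> S" "x = g \<otimes> s \<otimes> inv g"
proof -
  obtain xs where xs: "xs \<in> lists S" "w = word_prod xs" using word[OF assms(1)] .
  have "\<exists>g\<in>carrier G. \<exists>s\<in>S. x = g \<otimes> s \<otimes> inv g"
    using xs(1) assms(2) assms(3)[unfolded xs(2)]
  proof (induction xs arbitrary: x)
    case Nil
    then show ?case using cocycle_one by simp
  next
    case (Cons s xs)
    note p = word_prod_closed[OF Cons(2)]
    show ?case
    proof (cases "x = s")
      case True
      then show ?thesis using Cons(1) by (intro bexI[of _ \<one>] bexI[of _ s]) auto
    next
      case False
      then have "\<nu> (word_prod xs) (s \<otimes> x \<otimes> s)"
        using Cons.prems Cons(1) p by (simp add: cocycle_gen_mult)
      then obtain g t where gt: "g \<in> carrier G" "t \<in> S" "s \<otimes> x \<otimes> s = g \<otimes> t \<otimes> inv g"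
        using Cons.IH[of "s \<otimes> x \<otimes> s"] Cons.prems Cons(1) by auto
      have "x = s \<otimes> (s \<otimes> x \<otimes> s) \<otimes> s"
        using Cons.prems Cons(1) by (simp add: m_assoc gen_cancel gens_involutive)
      also have "\<dots> = (s \<otimes> g) \<otimes> t \<otimes> inv (s \<otimes> g)"
        unfolding gt(3) using Cons(1) gt(1,2) by (simp add: m_assoc inv_mult_group gen_inv)
      finally show ?thesis
        using Cons(1) gt(1,2) by (intro bexI[of _ "s \<otimes> g"] bexI[of _ t]) auto
    qed
  qed
  then show thesis using that by blast
qed

section \<open>Inversions of central elements\<close>

text \<open>Expand \<open>\<nu>\<close> of \<open>z \<otimes> g = g \<otimes> z\<close> at the
  conjugate in both orders. Conjugation by \<open>z\<close> is trivial, so the term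
  \<open>\<nu> g\<close> occurs on both sides and cancels.\<close>

lemma central_cocycle_conjugate:
  assumes "z \<in> group_center G" "g \<in> carrier G" "x \<in> carrier G"
  shows "\<nu> z (g \<otimes> x \<otimes> inv g) \<longleftrightarrow> \<nu> z x"
proof -
  have z: "z \<in> carrier G" "\<And>y. y \<in> carrier G \<Longrightarrow> z \<otimes> y = y \<otimes> z"
    using assms by (auto simp: group_center_def)
  have inv_z: "inv z \<otimes> y \<otimes> z = y" if "y \<in> carrier G" for y
    using z(1) that by (simp add: m_assoc z(2)[OF that, symmetric]) (simp flip: m_assoc)
  let ?y = "g \<otimes> x \<otimes> inv g"
  have y: "?y \<in> carrier G" "inv g \<otimes> ?y \<otimes> g = x"
    using assms by (simp_all add: m_assoc) (simp flip: m_assoc)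
  show ?thesis
    using cocycle_mult[of z g ?y] cocycle_mult[of g z ?y] z(1) z(2)[OF assms(2)] inv_z[OF y(1)] y assms
    by auto
qed

text \<open>Take \<open>b\<close> of least word length with
  \<open>w \<in> \<langle>I\<rangle> b\<close>. An inversion
  \<open>x \<in> \<langle>I\<rangle>\<close> of \<open>b\<close> would make
  \<open>x \<otimes> b\<close> shorter, and \<open>a \<otimes> inv x\<close> absorbs the
  change.\<close>

lemma parabolic_factorization:
  assumes I: "I \<subseteq> S" and w: "w \<in> carrier G"
  obtains a b where "a \<in> generate G I" "b \<in> carrier G" "w = a \<otimes> b"
    "\<And>x. x \<in> generate G I \<Longrightarrow> \<not> \<nu> b x"
proof -
  have sub: "subgroup (generate G I) G"
    using I gens_closed by (intro generate_is_subgroup) auto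
  let ?P = "\<lambda>xs. xs \<in> lists S \<and> (\<exists>a\<in>generate G I. w = a \<otimes> word_prod xs)"
  obtain xs where "xs \<in> lists S" "w = word_prod xs" using word[OF w] .
  then have "?P xs" using w generate.one by force
  then obtain xs where xs: "xs \<in> lists S" "\<exists>a\<in>generate G I. w = a \<otimes> word_prod xs"
    and min: "\<And>ys. ?P ys \<Longrightarrow> length xs \<le> length ys"
    using ex_has_least_nat[of ?P xs length] by blast
  then obtain a where a: "a \<in> generate G I" "w = a \<otimes> word_prod xs" by blast
  have "\<not> \<nu> (word_prod xs) x" if x: "x \<in> generate G I" for x
  proof
    assume "\<nu> (word_prod xs) x"
    moreover have xc: "x \<in> carrier G" "a \<in> carrier G"
      using subgroup.mem_carrier[OF sub] x a by auto
    ultimately obtain ys where ys: "ys \<in> lists S" "length ys < length xs"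
      "x \<otimes> word_prod xs = word_prod ys"
      using exchange[OF subset_refl xs(1)] by blast
    note p = word_prod_closed[OF xs(1)]
    have "word_prod xs = inv x \<otimes> word_prod ys"
      unfolding ys(3)[symmetric] using xc p by (simp flip: m_assoc)
    then have "w = (a \<otimes> inv x) \<otimes> word_prod ys"
      using a(2) xc word_prod_closed[OF ys(1)] by (simp add: m_assoc)
    moreover have "a \<otimes> inv x \<in> generate G I"
      using sub a x by (simp add: subgroup.m_closed subgroup.m_inv_closed)
    ultimately show False using min[of ys] ys by force
  qed
  then show thesis using that a word_prod_closed[OF xs(1)] by blast
qed

text \<open>Inversions of \<open>z\<close> are closed under conjugation. Write \<open>z = ab\<close> with \<open>a \<in> \<langle>s, t\<rangle>\<close> and \<open>b\<close> without
  inversions in \<open>\<langle>s, t\<rangle>\<close>. Then \<open>sa\<close> has neither \<open>s\<close> nor \<open>t\<close> as an inversion, so \<open>a = s\<close>; but \<open>tst\<close> is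
  an inversion of \<open>z\<close>, hence of \<open>a\<close>, which forces \<open>tst = s\<close>.\<close>

lemma central_descents_commute:
  assumes z: "z \<in> group_center G" and s: "s \<in> S" "\<nu> z s" and t: "t \<in> S" "\<not> \<nu> z t"
  shows "s \<otimes> t = t \<otimes> s"
proof -
  let ?I = "{s, t}"
  have I: "?I \<subseteq> S" and zc: "z \<in> carrier G" and c: "s \<in> carrier G" "t \<in> carrier G"
    using s t z by (auto simp: group_center_def)
  have st: "s \<in> generate G ?I" "t \<in> generate G ?I" by (auto intro: generate.incl)
  obtain a b where ab: "a \<in> generate G ?I" "b \<in> carrier G" "z = a \<otimes> b"
    and b: "\<And>x. x \<in> generate G ?I \<Longrightarrow> \<not> \<nu> b x"
    using parabolic_factorization[OF I zc] by blast
  have sub: "subgroup (generate G ?I) G"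
    using c by (intro generate_is_subgroup) auto
  note ac = subgroup.mem_carrier[OF sub ab(1)]
  \<comment> \<open>Conjugation by \<open>a\<close> preserves the subgroup, where \<open>b\<close>
    has no inversions, so the second term of the cocycle identity vanishes.\<close>
  have az: "\<nu> a x \<longleftrightarrow> \<nu> z x" if "x \<in> generate G ?I" for x
  proof -
    have "inv a \<otimes> x \<otimes> a \<in> generate G ?I"
      using that ab(1) sub by (simp add: subgroup.m_closed subgroup.m_inv_closed)
    then show ?thesis
      using cocycle_mult[OF ac ab(2) subgroup.mem_carrier[OF sub that]] b unfolding ab(3) by blast
  qed
  have sts: "s \<otimes> t \<otimes> s \<in> generate G ?I" "t \<otimes> s \<otimes> t \<in> generate G ?I"
    using st by (auto intro: generate.eng)
  have conj: "\<nu> z (s \<otimes> t \<otimes> s) \<longleftrightarrow> \<nu> z t" "\<nu> z (t \<otimes> s \<otimes> t) \<longleftrightarrow> \<nu> z s"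
    using central_cocycle_conjugate[OF z, of s t] central_cocycle_conjugate[OF z, of t s] s t
    by (simp_all add: gen_inv)
  \<comment> \<open>At \<open>s\<close> both terms of the identity are true and cancel. At
    \<open>t\<close> both are false: \<open>t \<noteq> s\<close>, as only \<open>s\<close> is an
    inversion of \<open>z\<close>, and \<open>s \<otimes> t \<otimes> s\<close> is conjugate to
    \<open>t\<close>.\<close>
  have "\<not> \<nu> (s \<otimes> a) s" "\<not> \<nu> (s \<otimes> a) t"
    using s t c ac az[OF st(1)] az[OF sts(1)] conj
    by (auto simp: cocycle_gen_mult gens_involutive)
  moreover have "s \<otimes> a \<in> generate G ?I" using st ab by (auto intro: generate.eng)
  ultimately have "s \<otimes> a = \<one>" using descent_exists[OF I] by blast
  then have "a = s" using s c ac gen_inv by (metis inv_equality inv_inv)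
  then have "t \<otimes> s \<otimes> t = s"
    using az[OF sts(2)] conj s c by (simp add: cocycle_gen)
  then show ?thesis using c gen_cancel[OF t(1), of "s \<otimes> t"] by (simp add: m_assoc)
qed

lemma central_no_descents:
  assumes "z \<in> group_center G" "\<And>s. s \<in> S \<Longrightarrow> \<not> \<nu> z s"
  shows "z = \<one>"
  using assms descent_exists[of S z] gens_generate by (auto simp: group_center_def)

text \<open>Sending \<open>w\<close> to its inversion set embeds the group into the power set of the
  finite inversion set of \<open>z\<close>.\<close>

lemma central_full_descents_imp_finite:
  assumes z: "z \<in> group_center G" and full: "\<And>s. s \<in> S \<Longrightarrow> \<nu> z s"
  shows "finite (carrier G)"
proof -
  let ?N = "\<lambda>w. {x \<in> carrier G. \<nu> w x}"
  have zc: "z \<in> carrier G" using z by (simp add: group_center_def)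
  have "?N w \<subseteq> ?N z" if w: "w \<in> carrier G" for w
  proof
    fix x assume x: "x \<in> ?N w"
    then obtain g s where "g \<in> carrier G" "s \<in> S" "x = g \<otimes> s \<otimes> inv g"
      using inversion_is_reflection[OF w] by blast
    then show "x \<in> ?N z" using central_cocycle_conjugate[OF z] full x by auto
  qed
  then have "?N ` carrier G \<subseteq> Pow (?N z)" by blast
  then have "finite (?N ` carrier G)"
    using finite_inversions[OF zc] finite_subset by blast
  moreover have "inj_on ?N (carrier G)"
    by (intro inj_onI cocycle_inj) blast+
  ultimately show ?thesis by (rule finite_imageD)
qed

end

section \<open>The inversion cocycle of a Coxeter system\<close>

text \<open>The boolean is the sign. Pairs outside the carrier are fixed, so that an involution
  \<open>s\<close> acts by a bijection of the whole type.\<close>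

definition reflection_perm :: "('a, 'b) monoid_scheme \<Rightarrow> 'a \<Rightarrow> 'a \<times> bool \<Rightarrow> 'a \<times> bool" where
  "reflection_perm G s = (\<lambda>(x, b).
     if x \<in> carrier G then (s \<otimes>\<^bsub>G\<^esub> x \<otimes>\<^bsub>G\<^esub> s, b \<noteq> (x = s)) else (x, b))"

text \<open>Over \<open>UNIV\<close> the extensionality built into \<open>BijGroup\<close> is
  vacuous, which leaves plain composition.\<close>

lemma BijGroup_UNIV [simp]:
  "carrier (BijGroup UNIV) = {f. bij f}"
  "\<one>\<^bsub>BijGroup UNIV\<^esub> = id"
  "bij f \<Longrightarrow> bij g \<Longrightarrow> f \<otimes>\<^bsub>BijGroup UNIV\<^esub> g = f \<circ> g"
  by (auto simp: BijGroup_def Bij_def compose_def fun_eq_iff)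

lemma BijGroup_UNIV_pow:
  assumes "bij f"
  shows "f [^]\<^bsub>BijGroup UNIV\<^esub> (n::nat) = f ^^ n"
proof (induction n)
  case 0
  then show ?case by (simp add: nat_pow_def)
next
  case (Suc n)
  interpret B: group "BijGroup UNIV" by (rule group_BijGroup)
  have "bij (f ^^ n)" using assms by (rule bij_betw_funpow)
  then show ?case using Suc assms by (simp only: B.nat_pow_Suc BijGroup_UNIV funpow_Suc_right)
qed

context group
begin

text \<open>The sign flips twice or never, because \<open>s \<otimes> x \<otimes> s = s\<close>
  exactly when \<open>x = s\<close>.\<close>

lemma reflection_perm_involutive:
  assumes "s \<in> carrier G" "s \<otimes> s = \<one>"
  shows "reflection_perm G s (reflection_perm G s p) = p"
proof (cases p)
  case (Pair x b)
  show ?thesis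
  proof (cases "x \<in> carrier G")
    case True
    have "s \<otimes> (s \<otimes> y) = y" if "y \<in> carrier G" for y
      using assms that by (simp flip: m_assoc)
    then have "s \<otimes> (s \<otimes> x \<otimes> s) \<otimes> s = x"
      using assms True by (simp add: m_assoc)
    moreover have "s \<otimes> x \<otimes> s = s \<longleftrightarrow> x = s"
    proof
      assume "s \<otimes> x \<otimes> s = s"
      then have "s \<otimes> (s \<otimes> x \<otimes> s) \<otimes> s = s" using assms by simp
      then show "x = s" using calculation by simp
    qed (use assms in simp)
    ultimately show ?thesis using Pair True assms by (auto simp: reflection_perm_def)
  qed (use Pair in \<open>simp add: reflection_perm_def\<close>)
qed

lemma bij_reflection_perm:
  assumes "s \<in> carrier G" "s \<otimes> s = \<one>"
  shows "bij (reflection_perm G s)"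
  using reflection_perm_involutive[OF assms] by (intro o_bij[of "reflection_perm G s"]) auto

text \<open>The first component runs through the conjugates of \<open>x\<close> by the final segments of the word
  \<open>st\<dots>st\<close>, and the sign changes whenever the next letter is met, i.e. when \<open>x\<close> is
  \<open>(ts)\<^sup>it\<close> for some \<open>i < 2n\<close>.\<close>

lemma reflection_perm_pow:
  assumes s: "s \<in> carrier G" "s \<otimes> s = \<one>" and t: "t \<in> carrier G" "t \<otimes> t = \<one>"
    and x: "x \<in> carrier G"
  shows "((reflection_perm G s \<circ> reflection_perm G t) ^^ n) (x, b) =
    ((s \<otimes> t) [^] n \<otimes> x \<otimes> (t \<otimes> s) [^] n,
     b \<noteq> odd (\<Sum>i<2 * n. of_bool (x = (t \<otimes> s) [^] i \<otimes> t) :: nat))"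
proof (induction n)
  case 0
  then show ?case using x by simp
next
  case (Suc n)
  let ?c = "s \<otimes> t" and ?e = "t \<otimes> s"
  have inv: "inv s = s" "inv t = t" using s t by (simp_all add: inv_equality)
  have ce: "inv ?e = ?c" "inv ?c = ?e" using s(1) t(1) by (simp_all add: inv_mult_group inv)
  let ?p = "?c [^] n" and ?q = "?e [^] n"
  have c: "?c \<in> carrier G" "?e \<in> carrier G" "?p \<in> carrier G" "?q \<in> carrier G"
    using s t by simp_all
  have "inv ?q = ?p" "inv ?p = ?q" using c by (simp_all add: nat_pow_inv[symmetric] ce)
  then have pq: "?p \<otimes> ?q = \<one>" "?q \<otimes> ?p = \<one>"
    using c l_inv[of ?p] l_inv[of ?q] by simp_all
  \<comment> \<open>Moving \<open>t\<close> across a power swaps \<open>s \<otimes> t\<close> for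
    \<open>t \<otimes> s\<close>; this collapses the conjugates below into single powers of
    \<open>t \<otimes> s\<close> times \<open>t\<close>.\<close>
  have tc: "t \<otimes> ?c [^] k = ?e [^] k \<otimes> t" for k :: nat
  proof (induction k)
    case (Suc k)
    have "t \<otimes> ?c [^] Suc k = (t \<otimes> ?c [^] k) \<otimes> ?c" using c t by (simp add: m_assoc)
    also have "\<dots> = ?e [^] Suc k \<otimes> t" unfolding Suc using c s t by (simp add: m_assoc)
    finally show ?case .
  qed (use t in simp)
  define y where "y = ?p \<otimes> x \<otimes> ?q"
  have y: "y \<in> carrier G" using c x by (simp add: y_def)
  have flip: "y = z \<longleftrightarrow> x = ?q \<otimes> z \<otimes> ?p" if z: "z \<in> carrier G" for z
  proof
    assume "y = z"
    have "?q \<otimes> y \<otimes> ?p = (?q \<otimes> ?p) \<otimes> x \<otimes> (?q \<otimes> ?p)"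
      using c x unfolding y_def by (simp only: m_assoc m_closed)
    then show "x = ?q \<otimes> z \<otimes> ?p" using \<open>y = z\<close> x by (simp add: pq)
  next
    assume x_eq: "x = ?q \<otimes> z \<otimes> ?p"
    have "y = (?p \<otimes> ?q) \<otimes> z \<otimes> (?p \<otimes> ?q)"
      using c z unfolding y_def x_eq by (simp only: m_assoc m_closed)
    then show "y = z" using z by (simp add: pq)
  qed
  have qtp: "?q \<otimes> t \<otimes> ?p = ?e [^] (2 * n) \<otimes> t"
  proof -
    have "?q \<otimes> t \<otimes> ?p = (?q \<otimes> ?q) \<otimes> t" using c t by (simp add: m_assoc tc)
    then show ?thesis using c by (simp add: nat_pow_mult mult_2)
  qed
  \<comment> \<open>The next factor compares \<open>y\<close> with \<open>t\<close> and then
    \<open>t \<otimes> y \<otimes> t\<close> with \<open>s\<close>. Pulled back to \<open>x\<close>,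
    these tests are the summands with indices \<open>2 * n\<close> and
    \<open>Suc (2 * n)\<close>.\<close>
  have 1: "y = t \<longleftrightarrow> x = ?e [^] (2 * n) \<otimes> t"
    using flip[OF t(1)] qtp by simp
  have 2: "t \<otimes> y \<otimes> t = s \<longleftrightarrow> x = ?e [^] Suc (2 * n) \<otimes> t"
  proof -
    have tt: "t \<otimes> (t \<otimes> z) = z" if "z \<in> carrier G" for z
      using t that by (simp flip: m_assoc)
    have "t \<otimes> y \<otimes> t = s \<longleftrightarrow> y = t \<otimes> s \<otimes> t"
    proof
      assume "t \<otimes> y \<otimes> t = s"
      then show "y = t \<otimes> s \<otimes> t" using t y by (auto simp: m_assoc tt)
    next
      assume "y = t \<otimes> s \<otimes> t"
      then show "t \<otimes> y \<otimes> t = s" using t s by (simp add: m_assoc tt)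
    qed
    also have "\<dots> \<longleftrightarrow> x = ?q \<otimes> (?e \<otimes> t) \<otimes> ?p" using flip[of "t \<otimes> s \<otimes> t"] s t by simp
    also have "?q \<otimes> (?e \<otimes> t) \<otimes> ?p = ?q \<otimes> ?e \<otimes> (t \<otimes> ?p)"
      using c t by (simp only: m_assoc m_closed)
    also have "\<dots> = ?e [^] Suc n \<otimes> ?e [^] n \<otimes> t" using c t by (simp add: tc m_assoc)
    also have "\<dots> = ?e [^] Suc (2 * n) \<otimes> t"
      using c by (simp only: nat_pow_mult) (simp add: mult_2)
    finally show ?thesis .
  qed
  have 3: "s \<otimes> (t \<otimes> y \<otimes> t) \<otimes> s = ?c [^] Suc n \<otimes> x \<otimes> ?e [^] Suc n"
  proof -
    have "s \<otimes> (t \<otimes> y \<otimes> t) \<otimes> s = (?c \<otimes> ?p) \<otimes> x \<otimes> (?q \<otimes> ?e)"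
      using s t c x unfolding y_def by (simp only: m_assoc m_closed)
    also have "?c \<otimes> ?p = ?c [^] Suc n" using c by (metis nat_pow_Suc2)
    finally show ?thesis by simp
  qed
  have tyt: "t \<otimes> y \<otimes> t \<in> carrier G" using t y by simp
  have "((reflection_perm G s \<circ> reflection_perm G t) ^^ Suc n) (x, b) =
    reflection_perm G s (reflection_perm G t
      (y, b \<noteq> odd (\<Sum>i<2 * n. of_bool (x = ?e [^] i \<otimes> t) :: nat)))"
    unfolding y_def funpow.simps(2) comp_apply[of _ _ "(x, b)"] Suc.IH by (simp only: comp_apply)
  also have "\<dots> = (s \<otimes> (t \<otimes> y \<otimes> t) \<otimes> s,
      ((b \<noteq> odd (\<Sum>i<2 * n. of_bool (x = ?e [^] i \<otimes> t) :: nat)) \<noteq> (y = t)) \<noteq> (t \<otimes> y \<otimes> t = s))"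
    using y tyt by (simp only: reflection_perm_def prod.case if_True)
  also have "\<dots> = (?c [^] Suc n \<otimes> x \<otimes> ?e [^] Suc n,
      b \<noteq> odd (\<Sum>i<2 * Suc n. of_bool (x = ?e [^] i \<otimes> t) :: nat))"
  proof -
    have "2 * Suc n = Suc (Suc (2 * n))" by simp
    then show ?thesis unfolding 1 2 3 by (simp only: sum.lessThan_Suc) auto
  qed
  finally show ?case .
qed

lemma reflection_perm_relation:
  assumes s: "s \<in> carrier G" "s \<otimes> s = \<one>" and t: "t \<in> carrier G" "t \<otimes> t = \<one>"
    and k: "(s \<otimes> t) [^] (k::nat) = \<one>"
  shows "(reflection_perm G s \<circ> reflection_perm G t) ^^ k = id"
proof
  fix p :: "'a \<times> bool"
  obtain x b where p: "p = (x, b)" by (cases p)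
  let ?f = "reflection_perm G s \<circ> reflection_perm G t"
  show "(?f ^^ k) p = id p"
  proof (cases "x \<in> carrier G")
    case True
    let ?e = "t \<otimes> s"
    let ?h = "\<lambda>i. of_bool (x = ?e [^] i \<otimes> t) :: nat"
    have "inv (s \<otimes> t) = ?e" using s t by (simp add: inv_mult_group inv_equality)
    then have e: "?e [^] k = \<one>" using k s t by (metis inv_one m_closed nat_pow_inv)
    have "?h (i + k) = ?h i" for i
      using s t e by (simp flip: nat_pow_mult)
    moreover have "(\<Sum>i<2 * k. ?h i) = (\<Sum>i<k. ?h i) + (\<Sum>i<k. ?h (i + k))"
      using sum.atLeastLessThan_concat[of 0 k "2 * k" ?h] sum.shift_bounds_nat_ivl[of ?h 0 k k]
      by (simp add: mult_2 atLeast0LessThan)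
    ultimately have "even (\<Sum>i<2 * k. ?h i)" by simp
    then show ?thesis
      using reflection_perm_pow[OF s t True, of k b] k e True p by simp
  next
    case False
    then have "?f p = p" using p by (simp add: reflection_perm_def)
    then have "(?f ^^ k) p = p" by (induction k) auto
    then show ?thesis by simp
  qed
qed

end

text \<open>The signed permutations satisfy the Coxeter relations, so they extend to an action of
  \<open>W\<close>; its sign part supplies the cocycle.\<close>

lemma coxeter_reflection_cocycle:
  assumes "group W" "S \<subseteq> carrier W" "coxeter_matrix S m"
    and pres: "has_presentation W S (coxeter_relators S m)"
  obtains \<nu> where "reflection_cocycle W S \<nu>"
proof -
  interpret W: group W by fact
  have gen: "generate W S = carrier W"
    using presentation_generated[OF pres assms(1) coxeter_relators_closed] .
  have S: "s \<in> carrier W" "s \<otimes>\<^bsub>W\<^esub> s = \<one>\<^bsub>W\<^esub>" if "s \<in> S" for s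
  proof -
    show "s \<in> carrier W" using that assms(2) by blast
    moreover have "m s s = enat 1" using that assms(3) by (simp add: coxeter_matrix_def one_enat_def)
    ultimately show "s \<otimes>\<^bsub>W\<^esub> s = \<one>\<^bsub>W\<^esub>"
      using coxeter_relation[OF pres assms(1) that that, of 1] by simp
  qed
  let ?B = "BijGroup (UNIV :: ('a \<times> bool) set)"
  interpret B: group ?B by (rule group_BijGroup)
  have "reflection_perm W \<in> S \<rightarrow> carrier ?B"
    using W.bij_reflection_perm[OF S] by simp
  moreover have "(reflection_perm W s \<otimes>\<^bsub>?B\<^esub> reflection_perm W t) [^]\<^bsub>?B\<^esub> k = \<one>\<^bsub>?B\<^esub>"
    if "s \<in> S" "t \<in> S" "m s t = enat k" for s t k
    using that W.bij_reflection_perm[OF S] coxeter_relation[OF pres assms(1) that]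
      W.reflection_perm_relation[OF S S]
    by (simp add: BijGroup_UNIV_pow bij_comp)
  ultimately obtain h where h: "h \<in> hom W ?B" "\<And>s. s \<in> S \<Longrightarrow> h s = reflection_perm W s"
    using coxeter_universal[OF pres assms(1) B.is_group] by blast
  interpret h: group_hom W ?B h using h(1) by unfold_locales
  have bij: "bij (h g)" if "g \<in> carrier W" for g using h.hom_closed[OF that] by simp
  have h_mult: "h (a \<otimes>\<^bsub>W\<^esub> b) p = h a (h b p)" if "a \<in> carrier W" "b \<in> carrier W" for a b p
    using that bij by simp
  define \<eta> where "\<eta> g x = snd (h g (x, False))" for g x
  have h_eq: "h g (x, b) = (g \<otimes>\<^bsub>W\<^esub> x \<otimes>\<^bsub>W\<^esub> inv\<^bsub>W\<^esub> g, b \<noteq> \<eta> g x)"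
    if g: "g \<in> carrier W" and x: "x \<in> carrier W" for g x b
  proof -
    have gen_inv: "inv\<^bsub>W\<^esub> s = s" if "s \<in> S" for s using S[OF that] by (simp add: W.inv_equality)
    have "g \<in> generate W S" using g gen by simp
    then have "g \<in> carrier W \<and> (\<forall>x\<in>carrier W. \<forall>b. h g (x, b) =
      (g \<otimes>\<^bsub>W\<^esub> x \<otimes>\<^bsub>W\<^esub> inv\<^bsub>W\<^esub> g, b \<noteq> \<eta> g x))"
    proof induction
      case one
      then show ?case by (simp add: \<eta>_def)
    next
      case (incl s)
      then show ?case using S by (simp add: h reflection_perm_def \<eta>_def gen_inv)
    next
      case (inv s)
      \<comment> \<open>Without \<open>h.hom_inv\<close>, \<open>inv s\<close> rewrites to
        \<open>s\<close> before \<open>h\<close> turns it into an inverse permutation.\<close>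
      then show ?case using S by (simp add: h reflection_perm_def \<eta>_def gen_inv del: h.hom_inv)
    next
      case (eng a c)
      have "h (a \<otimes>\<^bsub>W\<^esub> c) (x, b) = (a \<otimes>\<^bsub>W\<^esub> c \<otimes>\<^bsub>W\<^esub> x \<otimes>\<^bsub>W\<^esub> inv\<^bsub>W\<^esub> (a \<otimes>\<^bsub>W\<^esub> c),
        (b \<noteq> \<eta> c x) \<noteq> \<eta> a (c \<otimes>\<^bsub>W\<^esub> x \<otimes>\<^bsub>W\<^esub> inv\<^bsub>W\<^esub> c))" if "x \<in> carrier W" for x b
        using eng that by (simp add: h_mult W.inv_mult_group W.m_assoc del: h.hom_mult)
      moreover from this have "\<eta> (a \<otimes>\<^bsub>W\<^esub> c) x \<longleftrightarrow> \<eta> c x \<noteq> \<eta> a (c \<otimes>\<^bsub>W\<^esub> x \<otimes>\<^bsub>W\<^esub> inv\<^bsub>W\<^esub> c)"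
        if "x \<in> carrier W" for x
        using that unfolding \<eta>_def[of "a \<otimes>\<^bsub>W\<^esub> c"] by simp
      ultimately show ?case using eng by auto
    qed
    then show ?thesis using x by blast
  qed
  have \<eta>_mult: "\<eta> (a \<otimes>\<^bsub>W\<^esub> b) x \<longleftrightarrow> \<eta> b x \<noteq> \<eta> a (b \<otimes>\<^bsub>W\<^esub> x \<otimes>\<^bsub>W\<^esub> inv\<^bsub>W\<^esub> b)"
    if "a \<in> carrier W" "b \<in> carrier W" "x \<in> carrier W" for a b x
    using h_mult[OF that(1,2), of "(x, False)"] that by (simp add: h_eq del: h.hom_mult)
  \<comment> \<open>\<open>\<eta>\<close> conjugates by the right factor \<open>b\<close>. Passing
    to inverses reverses products and gives the left-hand convention of the locale.\<close>
  have "reflection_cocycle W S (\<lambda>g. \<eta> (inv\<^bsub>W\<^esub> g))"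
  proof
    show "S \<subseteq> carrier W" "generate W S = carrier W" by fact+
    show "s \<otimes>\<^bsub>W\<^esub> s = \<one>\<^bsub>W\<^esub>" if "s \<in> S" for s using S(2)[OF that] .
    show "\<eta> (inv\<^bsub>W\<^esub> s) x \<longleftrightarrow> x = s" if "s \<in> S" "x \<in> carrier W" for s x
    proof -
      have "inv\<^bsub>W\<^esub> s = s" using S[OF that(1)] by (simp add: W.inv_equality)
      then show ?thesis using that by (simp add: \<eta>_def h reflection_perm_def)
    qed
    show "\<eta> (inv\<^bsub>W\<^esub> (a \<otimes>\<^bsub>W\<^esub> b)) x \<longleftrightarrow>
      \<eta> (inv\<^bsub>W\<^esub> a) x \<noteq> \<eta> (inv\<^bsub>W\<^esub> b) (inv\<^bsub>W\<^esub> a \<otimes>\<^bsub>W\<^esub> x \<otimes>\<^bsub>W\<^esub> a)"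
      if "a \<in> carrier W" "b \<in> carrier W" "x \<in> carrier W" for a b x
      using that by (simp add: W.inv_mult_group \<eta>_mult)
  qed
  then show thesis by (rule that)
qed

section \<open>Splitting along commuting sets of generators\<close>

text \<open>Commuting generators \<open>s \<noteq> t\<close> have even or infinite \<open>m s t\<close>, so killing the generators outside
  \<open>D\<close> defines a retraction of \<open>W\<close> onto \<open>\<langle>D\<rangle>\<close>; hence \<open>\<langle>D\<rangle>\<close> meets \<open>\<langle>S - D\<rangle>\<close> trivially.\<close>

lemma coxeter_direct_product:
  assumes "group W" "S \<subseteq> carrier W" "coxeter_matrix S m"
    and pres: "has_presentation W S (coxeter_relators S m)"
    and invol: "\<And>s. s \<in> S \<Longrightarrow> s \<otimes>\<^bsub>W\<^esub> s = \<one>\<^bsub>W\<^esub>"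
    and D: "D \<subseteq> S"
    and comm: "\<And>s t. s \<in> D \<Longrightarrow> t \<in> S - D \<Longrightarrow> s \<otimes>\<^bsub>W\<^esub> t = t \<otimes>\<^bsub>W\<^esub> s"
  shows "direct_product_of_generated W D (S - D)"
proof -
  interpret W: group W by fact
  define A where "A = generate W D"
  define B where "B = generate W (S - D)"
  have DS: "D \<subseteq> carrier W" "S - D \<subseteq> carrier W" using D assms(2) by auto
  have S: "s \<in> carrier W" if "s \<in> S" for s using that assms(2) by blast
  have A: "subgroup A W" and B: "subgroup B W"
    unfolding A_def B_def using DS by (auto intro: W.generate_is_subgroup)
  have AB: "x \<otimes>\<^bsub>W\<^esub> y = y \<otimes>\<^bsub>W\<^esub> x" if "x \<in> A" "y \<in> B" for x y
    using W.commute_generate[OF DS comm] that unfolding A_def B_def by blast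
  let ?f = "\<lambda>s. if s \<in> D then s else \<one>\<^bsub>W\<^esub>"
  have rel: "(?f s \<otimes>\<^bsub>W\<^esub> ?f t) [^]\<^bsub>W\<^esub> k = \<one>\<^bsub>W\<^esub>" if st: "s \<in> S" "t \<in> S" "m s t = enat k" for s t k
  proof -
    note r = coxeter_relation[OF pres assms(1) st]
    \<comment> \<open>The product of commuting involutions squares to \<open>\<one>\<close>; an odd
      power equal to \<open>\<one>\<close> would then make the product itself \<open>\<one>\<close>,
      so \<open>s = t\<close>.\<close>
    have ev: "even k" if "s \<noteq> t" "s \<otimes>\<^bsub>W\<^esub> t = t \<otimes>\<^bsub>W\<^esub> s"
    proof (rule ccontr)
      assume "odd k"
      have "(s \<otimes>\<^bsub>W\<^esub> t) \<otimes>\<^bsub>W\<^esub> (s \<otimes>\<^bsub>W\<^esub> t) = s \<otimes>\<^bsub>W\<^esub> (t \<otimes>\<^bsub>W\<^esub> t) \<otimes>\<^bsub>W\<^esub> s"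
        unfolding that(2) using S st by (simp add: W.m_assoc that(2)[symmetric])
      then have "(s \<otimes>\<^bsub>W\<^esub> t) \<otimes>\<^bsub>W\<^esub> (s \<otimes>\<^bsub>W\<^esub> t) = \<one>\<^bsub>W\<^esub>" using invol st S by simp
      then have "s \<otimes>\<^bsub>W\<^esub> t = \<one>\<^bsub>W\<^esub>" using W.pow_eq_one_odd[OF _ _ r \<open>odd k\<close>] S st by simp
      then have "s = t" using invol[OF st(2)] S st by (metis W.inv_equality)
      then show False using that by simp
    qed
    \<comment> \<open>For a mixed pair one image is \<open>\<one>\<close>, so the relation reduces
      to a power of a single involution.\<close>
    have "s [^]\<^bsub>W\<^esub> k = \<one>\<^bsub>W\<^esub>" if "s \<in> D" "t \<notin> D"
    proof -
      have "even k" using that comm[of s t] st by (intro ev) auto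
      then show ?thesis by (rule W.pow_eq_one_even[OF S[OF st(1)] invol[OF st(1)]])
    qed
    moreover have "t [^]\<^bsub>W\<^esub> k = \<one>\<^bsub>W\<^esub>" if "s \<notin> D" "t \<in> D"
    proof -
      have "even k" using that comm[of t s] st by (intro ev) auto
      then show ?thesis by (rule W.pow_eq_one_even[OF S[OF st(2)] invol[OF st(2)]])
    qed
    ultimately show ?thesis using r S st by auto
  qed
  obtain \<rho> where \<rho>: "\<rho> \<in> hom W W" "\<And>s. s \<in> S \<Longrightarrow> \<rho> s = ?f s"
  proof (rule coxeter_universal[OF pres assms(1) assms(1)])
    show "?f \<in> S \<rightarrow> carrier W" using S by simp
  qed (use rel in auto)
  have \<rho>A: "\<rho> x = x" if "x \<in> A" for x
  proof -
    have "id \<in> hom W W" by (simp add: hom_def)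
    then have "\<rho> x = id x"
      by (rule W.hom_eq_on_generate[OF \<rho>(1) _ assms(1) DS(1)])
        (use that D \<rho>(2) in \<open>auto simp: A_def\<close>)
    then show ?thesis by simp
  qed
  have \<rho>B: "\<rho> x = \<one>\<^bsub>W\<^esub>" if "x \<in> B" for x
  proof -
    have "(\<lambda>_. \<one>\<^bsub>W\<^esub>) \<in> hom W W" by (simp add: hom_def)
    then show ?thesis
      by (rule W.hom_eq_on_generate[OF \<rho>(1) _ assms(1) DS(2)])
        (use that \<rho>(2) in \<open>auto simp: B_def\<close>)
  qed
  have car: "x \<in> carrier W" if "x \<in> A \<or> x \<in> B" for x
    using that subgroup.mem_carrier[OF A] subgroup.mem_carrier[OF B] by blast
  let ?P = "subgroup_generated W D \<times>\<times> subgroup_generated W (S - D)"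
  let ?g = "\<lambda>(x, y). x \<otimes>\<^bsub>W\<^esub> y"
  have P: "carrier ?P = A \<times> B"
    using DS by (simp add: carrier_subgroup_generated A_def B_def Int_absorb1)
  have hom: "?g \<in> hom ?P W"
  proof (rule homI)
    fix u v assume "u \<in> carrier ?P" "v \<in> carrier ?P"
    then obtain a b c d where uv: "u = (a, b)" "v = (c, d)" "a \<in> A" "b \<in> B" "c \<in> A" "d \<in> B"
      unfolding P by blast
    have "a \<otimes>\<^bsub>W\<^esub> c \<otimes>\<^bsub>W\<^esub> (b \<otimes>\<^bsub>W\<^esub> d) = a \<otimes>\<^bsub>W\<^esub> (c \<otimes>\<^bsub>W\<^esub> b) \<otimes>\<^bsub>W\<^esub> d"
      using car uv by (simp add: W.m_assoc)
    also have "\<dots> = a \<otimes>\<^bsub>W\<^esub> b \<otimes>\<^bsub>W\<^esub> (c \<otimes>\<^bsub>W\<^esub> d)"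
      unfolding AB[OF uv(5,4)] using car uv by (simp add: W.m_assoc)
    finally show "?g (u \<otimes>\<^bsub>?P\<^esub> v) = ?g u \<otimes>\<^bsub>W\<^esub> ?g v"
      using uv by simp
  qed (use P car in auto)
  interpret g: group_hom ?P W ?g
    using hom by (simp add: group_hom_def group_hom_axioms_def W.is_group DirProd_group
      W.group_subgroup_generated)
  have "inj_on ?g (carrier ?P)"
  proof (rule inj_onI)
    fix u v assume "u \<in> carrier ?P" "v \<in> carrier ?P" and eq: "?g u = ?g v"
    then obtain a b c d where uv: "u = (a, b)" "v = (c, d)" "a \<in> A" "b \<in> B" "c \<in> A" "d \<in> B"
      unfolding P by blast
    \<comment> \<open>The retraction recovers the first factor from the product; cancellation then
      gives the second.\<close>
    have "\<rho> (x \<otimes>\<^bsub>W\<^esub> y) = x" if "x \<in> A" "y \<in> B" for x y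
      using hom_mult[OF \<rho>(1), of x y] that \<rho>A \<rho>B car by simp
    then have "a = c" using eq uv by (metis case_prod_conv)
    then show "u = v" using eq uv car by simp
  qed
  moreover have "?g ` carrier ?P = carrier W"
  proof
    have "s \<in> ?g ` carrier ?P" if s: "s \<in> S" for s
    proof (cases "s \<in> D")
      case True
      then have "(s, \<one>\<^bsub>W\<^esub>) \<in> carrier ?P"
        unfolding P by (auto simp: A_def B_def intro: generate.intros)
      then show ?thesis using S[OF s] by (intro image_eqI[of _ _ "(s, \<one>\<^bsub>W\<^esub>)"]) auto
    next
      case False
      then have "(\<one>\<^bsub>W\<^esub>, s) \<in> carrier ?P"
        unfolding P using s by (auto simp: A_def B_def intro: generate.intros)
      then show ?thesis using S[OF s] by (intro image_eqI[of _ _ "(\<one>\<^bsub>W\<^esub>, s)"]) auto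
    qed
    then have "generate W S \<subseteq> ?g ` carrier ?P"
      by (intro W.generate_subgroup_incl g.img_is_subgroup) blast
    then show "carrier W \<subseteq> ?g ` carrier ?P"
      using presentation_generated[OF pres assms(1) coxeter_relators_closed] by simp
    show "?g ` carrier ?P \<subseteq> carrier W"
      unfolding P using car by auto
  qed
  ultimately show ?thesis
    using hom unfolding direct_product_of_generated_def iso_def bij_betw_def by blast
qed

section \<open>Triviality of the center\<close>

theorem corollary1p3:
  fixes W :: "('a, 'b) monoid_scheme" and S :: "'a set"
  assumes "irreducible_coxeter_system W S"
    and "finite S"
    and "infinite (carrier W)"
  shows "group_center W = {\<one>\<^bsub>W\<^esub>}"
proof -
  obtain m where W: "group W" "S \<subseteq> carrier W" "coxeter_matrix S m"
      "has_presentation W S (coxeter_relators S m)"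
    and irr: "\<And>T. T \<noteq> {} \<Longrightarrow> T \<subset> S \<Longrightarrow> \<not> direct_product_of_generated W T (S - T)"
    using assms(1) unfolding irreducible_coxeter_system_def coxeter_system_def by metis
  obtain \<nu> where "reflection_cocycle W S \<nu>" using coxeter_reflection_cocycle[OF W] .
  then interpret reflection_cocycle W S \<nu> .
  have "z = \<one>\<^bsub>W\<^esub>" if z: "z \<in> group_center W" for z
  proof -
    let ?D = "{s \<in> S. \<nu> z s}"
    have "direct_product_of_generated W ?D (S - ?D)"
    proof (rule coxeter_direct_product[OF W gens_involutive])
      show "s \<otimes>\<^bsub>W\<^esub> t = t \<otimes>\<^bsub>W\<^esub> s" if "s \<in> ?D" "t \<in> S - ?D" for s t
        using that by (intro central_descents_commute[OF z]) auto
    qed auto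
    then have "?D = {} \<or> ?D = S" using irr[of ?D] by blast
    \<comment> \<open>This also disposes of empty \<open>S\<close>, where full descents hold
      vacuously and would make \<open>W\<close> finite.\<close>
    moreover have "?D \<noteq> S" using central_full_descents_imp_finite[OF z] assms(3) by blast
    ultimately show ?thesis using central_no_descents[OF z] by blast
  qed
  moreover have "\<one>\<^bsub>W\<^esub> \<in> group_center W" by (simp add: group_center_def)
  ultimately show ?thesis by blast
qed

end
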